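(* Let $M$ be a quaternary isotopic propelinear MDS code of length $n$ and let $H$ be a binary extended Hamming code of length $n$. Then the code $$C=\bigcup_{(h_{1},\ldots,h_{n})\in H}\ \bigcup_{(a_{1},\ldots,a_{n})\in M} C_{a_{1}}^{h_{1}}\times\cdots\times C_{a_{n}}^{h_{n}}\subseteq \mathbb{F}_2^{4n}$$ is a binary propelinear extended perfect code of length $4n$.
   Context: Let $E_4=\{0,1,2,3\}$. A quaternary MDS code of length $n$ here means a subset of $E_4^n$ of size $4^{n-1}$ with minimum Hamming distance $2$. A multi-permutation is a tuple $\sigma=(\sigma_1,\ldots,\sigma_n)$ of permutations of $E_4$, acting by $\sigma(x_1,\ldots,x_n)=(\sigma_1(x_1),\ldots,\sigma_n(x_n))$. Multi-permutations are composed componentwise. A code $M\subseteq E_4^n$ is isotopic propelinear if to each $x\in M$ one can assign a multi-permutation $\sigma_x$ such that (i) $\sigma_x(M)=M$ and $\sigma_x(\mathbf 0)=x$ for every $x\in M$, where $\mathbf 0=(0,\ldots,0)$; and (ii) $\sigma_{\sigma_x(y)}=\sigma_x\circ\sigma_y$ for all $x,y\in M$. The four coordinate positions of $\mathbb{F}_2^4$ are indexed by the elements of $E_4$, with $0\in E_4$ denoting the fourth position and $a\in\{1,2,3\}$ denoting the $a$-th position. $e_a\in\mathbb{F}_2^4$ is the vector whose only nonzero entry is a $1$ in position $a$. Let $C_0=\{(0,0,0,0),(1,1,1,1)\}$, and for $r\in\{0,1\}$, $a\in E_4$ let $C_a^r=C_0+(1+r)e_0+e_a$ (with $1+r$ taken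 modulo $2$). A binary code $C\subseteq\mathbb{F}_2^N$ is propelinear if to each $x\in C$ one can assign a permutation $\pi_x$ of the $N$ coordinates, acting by $\pi(x_1,\ldots,x_N)=(x_{\pi^{-1}(1)},\ldots,x_{\pi^{-1}(N)})$, such that (i) $x+\pi_x(C)=C$ for every $x\in C$; and (ii) for all $x,y\in C$, if $z=x+\pi_x(y)$ then $\pi_z=\pi_x\circ\pi_y$. An extended perfect binary code is a code obtained from a perfect binary code with minimum distance $3$ by appending an overall parity check; an extended Hamming code is a linear such code (so its length $n$ is a power of $2$). *)

theory Defs
  imports Main "HOL-Library.Z2" "HOL-Combinatorics.Combinatorics"
begin

text \<open>Words of length \<open>n\<close> are lists, with coordinates numbered from \<open>0\<close>;
  the binary field is the type \<^typ>\<open>bit\<close>.\<close>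

definition words :: "'a set \<Rightarrow> nat \<Rightarrow> 'a list set" where
  "words A n = {x. set x \<subseteq> A \<and> length x = n}"

definition hamming_dist :: "'a list \<Rightarrow> 'a list \<Rightarrow> nat" where
  "hamming_dist x y = card {i. i < length x \<and> x ! i \<noteq> y ! i}"

text \<open>The value must be attained as soon as there are two codewords; a code with at most one
  word has every minimum distance. This admits the degenerate Hamming codes of lengths
  \<open>0\<close> and \<open>1\<close>.\<close>

definition has_min_distance :: "'a list set \<Rightarrow> nat \<Rightarrow> bool" where
  "has_min_distance C d \<longleftrightarrow>
     (\<forall>x\<in>C. \<forall>y\<in>C. x \<noteq> y \<longrightarrow> d \<le> hamming_dist x y) \<and>
     ((\<exists>x\<in>C. \<exists>y\<in>C. x \<noteq> y) \<longrightarrow> (\<exists>x\<in>C. \<exists>y\<in>C. x \<noteq> y \<and> hamming_dist x y = d))"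


subsection \<open>Quaternary codes\<close>

definition E4 :: "nat set" where
  "E4 = {0, 1, 2, 3}"

definition quaternary_mds :: "nat \<Rightarrow> nat list set \<Rightarrow> bool" where
  "quaternary_mds n M \<longleftrightarrow>
     0 < n \<and> M \<subseteq> words E4 n \<and> card M = 4 ^ (n - 1) \<and> has_min_distance M 2"

definition multiperm :: "nat \<Rightarrow> (nat \<Rightarrow> nat) list \<Rightarrow> bool" where
  "multiperm n s \<longleftrightarrow> length s = n \<and> (\<forall>p\<in>set s. p permutes E4)"

definition multiperm_apply :: "(nat \<Rightarrow> nat) list \<Rightarrow> nat list \<Rightarrow> nat list" where
  "multiperm_apply s x = map2 (\<lambda>p a. p a) s x"

definition multiperm_comp ::
    "(nat \<Rightarrow> nat) list \<Rightarrow> (nat \<Rightarrow> nat) list \<Rightarrow> (nat \<Rightarrow> nat) list" where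
  "multiperm_comp s t = map2 (\<circ>) s t"

definition isotopic_propelinear :: "nat \<Rightarrow> nat list set \<Rightarrow> bool" where
  "isotopic_propelinear n M \<longleftrightarrow> M \<subseteq> words E4 n \<and>
     (\<exists>\<sigma>. (\<forall>x\<in>M. multiperm n (\<sigma> x) \<and> multiperm_apply (\<sigma> x) ` M = M \<and>
                  multiperm_apply (\<sigma> x) (replicate n 0) = x) \<and>
          (\<forall>x\<in>M. \<forall>y\<in>M. \<sigma> (multiperm_apply (\<sigma> x) y) = multiperm_comp (\<sigma> x) (\<sigma> y)))"


subsection \<open>Binary codes\<close>

definition vadd :: "bit list \<Rightarrow> bit list \<Rightarrow> bit list" where
  "vadd x y = map2 (+) x y"

definition vscale :: "bit \<Rightarrow> bit list \<Rightarrow> bit list" where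
  "vscale c x = map ((*) c) x"

definition linear_code :: "nat \<Rightarrow> bit list set \<Rightarrow> bool" where
  "linear_code N C \<longleftrightarrow> C \<subseteq> words UNIV N \<and> replicate N 0 \<in> C \<and>
     (\<forall>x\<in>C. \<forall>y\<in>C. vadd x y \<in> C) \<and> (\<forall>c. \<forall>x\<in>C. vscale c x \<in> C)"

text \<open>Entry \<open>i\<close> of the image is entry \<open>inv p i\<close> of the word, hence the inverse.\<close>

definition perm_act :: "(nat \<Rightarrow> nat) \<Rightarrow> bit list \<Rightarrow> bit list" where
  "perm_act p x = permute_list (inv p) x"

definition propelinear :: "nat \<Rightarrow> bit list set \<Rightarrow> bool" where
  "propelinear N C \<longleftrightarrow> C \<subseteq> words UNIV N \<and>
     (\<exists>\<pi>. (\<forall>x\<in>C. \<pi> x permutes {..<N} \<and> (\<lambda>y. vadd x (perm_act (\<pi> x) y)) ` C = C) \<and>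
          (\<forall>x\<in>C. \<forall>y\<in>C. \<pi> (vadd x (perm_act (\<pi> x) y)) = \<pi> x \<circ> \<pi> y))"

text \<open>For minimum distance \<open>3\<close>, perfect means that the balls of radius \<open>1\<close> around the
  codewords partition the space.\<close>

definition perfect_code :: "nat \<Rightarrow> bit list set \<Rightarrow> bool" where
  "perfect_code N C \<longleftrightarrow> C \<subseteq> words UNIV N \<and> has_min_distance C 3 \<and>
     (\<forall>v\<in>words UNIV N. \<exists>!c. c \<in> C \<and> hamming_dist v c \<le> 1)"

definition append_parity :: "bit list \<Rightarrow> bit list" where
  "append_parity x = x @ [sum_list x]"

definition extended_perfect_code :: "nat \<Rightarrow> bit list set \<Rightarrow> bool" where
  "extended_perfect_code N C \<longleftrightarrow>
     (\<exists>m P. N = Suc m \<and> perfect_code m P \<and> C = append_parity ` P)"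

definition extended_hamming_code :: "nat \<Rightarrow> bit list set \<Rightarrow> bool" where
  "extended_hamming_code N H \<longleftrightarrow> extended_perfect_code N H \<and> linear_code N H"


subsection \<open>The concatenated code\<close>

text \<open>The symbol \<open>0\<close> labels the last of the four positions, \<open>a \<in> {1, 2, 3}\<close> the \<open>a\<close>-th one
  (index \<open>a - 1\<close>).\<close>

definition unit_vec :: "nat \<Rightarrow> bit list" where
  "unit_vec a = (replicate 4 0)[(if a = 0 then 3 else a - 1) := 1]"

definition repetition_code :: "bit list set" where
  "repetition_code = {[0, 0, 0, 0], [1, 1, 1, 1]}"

definition coset_code :: "bit \<Rightarrow> nat \<Rightarrow> bit list set" where
  "coset_code r a =
     (\<lambda>c. vadd (vadd c (vscale (1 + r) (unit_vec 0))) (unit_vec a)) ` repetition_code"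

text \<open>\<^const>\<open>listset\<close> is the Cartesian product of a list of sets; \<^const>\<open>concat\<close> identifies
  \<open>n\<close>-tuples of blocks with words of length \<open>4 * n\<close>.\<close>

definition concat_code :: "bit list set \<Rightarrow> nat list set \<Rightarrow> bit list set" where
  "concat_code H M = (\<Union>h\<in>H. \<Union>a\<in>M. concat ` listset (map2 coset_code h a))"

end

theory Submission imports Defs begin

text \<open>Each block of four coordinates carries a parity bit and a label, the \<open>XOR\<close> of the labels of
  the positions holding a \<open>1\<close>; \<open>C\<^sub>a\<^sup>r\<close> is exactly the set of blocks with parity \<open>r\<close> and label
  \<open>a\<close>. So a word lies in the concatenated code iff its parities lie in \<open>H\<close> and its labels in
  \<open>M\<close>. Distance and covering then follow from those of \<open>H\<close> and \<open>M\<close>: two words with different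
  parities differ in four blocks, with equal parities but different labels in two positions of at
  least two blocks, and with equal parities and labels in a whole block. To cover a word of odd
  weight, \<open>H\<close> singles out the block to be repaired, \<open>M\<close> its new label, and exactly one
  position of the block has the label to be added.

  For propelinearity, a permutation of \<open>E\<^sub>4\<close> is affine over \<open>XOR\<close>, and taking linear parts is
  a homomorphism. A codeword with labels \<open>a\<close> permutes the positions inside each block by the
  linear parts of \<open>\<sigma>\<^sub>a\<close>; adding the codeword supplies the translation part
  \<open>\<sigma>\<^sub>a(0) = a\<close>.\<close>

unbundle bit_operations_syntax

text \<open>Sums of bits stay field sums, so that \<open>ac_simps\<close> and
  \<open>sum_list\<close> apply to them; \<open>XOR\<close> is reserved for labels.\<close>

declare add_bit_eq_xor [simp del] mult_bit_eq_and [simp del]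

lemma bit_add_self [simp]: "a + a = (0::bit)"
  by (cases a) simp_all

subsection \<open>Hamming distance\<close>

lemma hamming_dist_Nil [simp]: "hamming_dist [] y = 0"
  by (simp add: hamming_dist_def)

lemma hamming_dist_Cons [simp]:
  "hamming_dist (a # x) (b # y) = of_bool (a \<noteq> b) + hamming_dist x y"
proof -
  have "{i. i < length (a # x) \<and> (a # x) ! i \<noteq> (b # y) ! i} =
      (if a \<noteq> b then {0} else {}) \<union> Suc ` {i. i < length x \<and> x ! i \<noteq> y ! i}"
    by (auto simp: image_iff less_Suc_eq_0_disj split: if_splits)
  moreover have "card \<dots> = of_bool (a \<noteq> b) + hamming_dist x y"
    by (subst card_Un_disjoint) (auto simp: card_image hamming_dist_def)
  ultimately show ?thesis
    unfolding hamming_dist_def by presburger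
qed

lemma hamming_dist_append:
  "length x = length x' \<Longrightarrow>
    hamming_dist (x @ y) (x' @ y') = hamming_dist x x' + hamming_dist y y'"
  by (induction x x' rule: list_induct2) auto

lemma hamming_dist_eq_0_iff: "length x = length y \<Longrightarrow> hamming_dist x y = 0 \<longleftrightarrow> x = y"
  by (induction x y rule: list_induct2) auto

lemma hamming_dist_commute: "length x = length y \<Longrightarrow> hamming_dist x y = hamming_dist y x"
  by (induction x y rule: list_induct2) auto

lemma hamming_dist_triangle:
  "length x = length y \<Longrightarrow> length y = length z \<Longrightarrow>
    hamming_dist x z \<le> hamming_dist x y + hamming_dist y z"
  by (induction x y z rule: list_induct3) (auto intro: order_trans)

lemma hamming_dist_update:
  "i < length x \<Longrightarrow> hamming_dist x (x[i := b]) = of_bool (x ! i \<noteq> b)"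
  by (induction x arbitrary: i)
    (auto simp: hamming_dist_eq_0_iff nth_Cons' less_Suc_eq_0_disj split: nat.splits)

text \<open>Over the field with two elements, \<open>a + b\<close> is the indicator of
  \<open>a \<noteq> b\<close>, so adding up the differences adds up both words.\<close>

lemma of_nat_hamming_dist:
  "length x = length y \<Longrightarrow> of_nat (hamming_dist x y) = (sum_list x + sum_list y :: bit)"
proof (induction x y rule: list_induct2)
  case (Cons a x b y)
  then show ?case by (cases a; cases b) (simp_all add: ac_simps)
qed simp

lemma even_hamming_dist_iff:
  fixes x y :: "bit list"
  assumes "length x = length y"
  shows "even (hamming_dist x y) \<longleftrightarrow> sum_list x = sum_list y"
proof -
  have "even (hamming_dist x y) \<longleftrightarrow> even (of_nat (hamming_dist x y) :: bit)"
    by (simp only: even_of_nat)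
  also have "\<dots> \<longleftrightarrow> sum_list x = sum_list y"
    unfolding of_nat_hamming_dist[OF assms] by (cases "sum_list x"; cases "sum_list y") simp_all
  finally show ?thesis .
qed

subsection \<open>Extended perfect codes\<close>

text \<open>Words of even weight lie at even distance, which lifts 3 to 4. For an odd word, the
  codeword covering its first \<open>m\<close> entries extends to one at distance at most 2, and
  parity leaves only 1.\<close>

lemma extended_perfect_codeD:
  assumes "extended_perfect_code N C"
  shows extended_perfect_code_words: "C \<subseteq> words UNIV N"
    and extended_perfect_code_even: "\<And>x. x \<in> C \<Longrightarrow> sum_list x = 0"
    and extended_perfect_code_dist:
      "\<And>x y. x \<in> C \<Longrightarrow> y \<in> C \<Longrightarrow> x \<noteq> y \<Longrightarrow> 4 \<le> hamming_dist x y"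
    and extended_perfect_code_covers:
      "\<And>v. length v = N \<Longrightarrow> sum_list v = 1 \<Longrightarrow> \<exists>c\<in>C. hamming_dist v c = 1"
proof -
  obtain m P where N: "N = Suc m" and P: "perfect_code m P" and C: "C = append_parity ` P"
    using assms by (auto simp: extended_perfect_code_def)
  have len: "length x = m" if "x \<in> P" for x
    using P that by (auto simp: perfect_code_def words_def)
  show W: "C \<subseteq> words UNIV N"
    using len by (auto simp: C N append_parity_def words_def)
  show E: "sum_list x = 0" if "x \<in> C" for x
    using that by (auto simp: C append_parity_def)
  show "4 \<le> hamming_dist x y" if xy: "x \<in> C" "y \<in> C" "x \<noteq> y" for x y
  proof -
    obtain p q where p: "p \<in> P" "x = append_parity p" and q: "q \<in> P" "y = append_parity q"
      using xy C by auto
    have "3 \<le> hamming_dist p q"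
      using P p q xy by (auto simp: perfect_code_def has_min_distance_def)
    then have "3 \<le> hamming_dist x y"
      using p q len by (simp add: append_parity_def hamming_dist_append)
    moreover have "even (hamming_dist x y)"
      using W E xy by (subst even_hamming_dist_iff) (auto simp: words_def subset_eq)
    ultimately show ?thesis
      by (cases "hamming_dist x y = 3") auto
  qed
  show "\<exists>c\<in>C. hamming_dist v c = 1" if v: "length v = N" "sum_list v = 1" for v
  proof -
    obtain w b where w: "v = w @ [b]" "length w = m"
      using v N by (cases v rule: rev_cases) auto
    then obtain c where c: "c \<in> P" "hamming_dist w c \<le> 1"
      using P unfolding perfect_code_def words_def by blast
    let ?c = "append_parity c"
    have "hamming_dist v ?c \<le> 2"
      using c w len by (auto simp: append_parity_def hamming_dist_append)
    moreover have "odd (hamming_dist v ?c)"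
      using W E[of ?c] c v C by (subst even_hamming_dist_iff) (auto simp: words_def subset_eq)
    ultimately have "hamming_dist v ?c = 1"
      by (cases "hamming_dist v ?c" rule: nat.exhaust) (auto simp: le_Suc_eq)
    then show ?thesis using c C by auto
  qed
qed

text \<open>Deleting the last coordinate loses at most 1 in each distance, and the radius-1 balls
  then cover by way of odd words. The bound on \<open>N\<close> leaves two coordinates to change
  when exhibiting distance exactly 3.\<close>

lemma extended_perfect_codeI:
  assumes N: "3 \<le> N"
    and W: "C \<subseteq> words UNIV N"
    and E: "\<And>x. x \<in> C \<Longrightarrow> sum_list x = 0"
    and D: "\<And>x y. x \<in> C \<Longrightarrow> y \<in> C \<Longrightarrow> x \<noteq> y \<Longrightarrow> 4 \<le> hamming_dist x y"
    and V: "\<And>v. length v = N \<Longrightarrow> sum_list v = 1 \<Longrightarrow> \<exists>c\<in>C. hamming_dist v c \<le> 1"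
  shows "extended_perfect_code N C"
proof -
  define m where "m = N - 1"
  define P where "P = butlast ` C"
  have Nm: "N = Suc m" and m2: "2 \<le> m"
    using N by (auto simp: m_def)
  have lenP: "length p = m" if "p \<in> P" for p
    using that W by (auto simp: P_def words_def m_def)
  \<comment> \<open>In a word of even weight the last bit is the parity of the others.\<close>
  have ap: "append_parity (butlast x) = x" if x: "x \<in> C" for x
  proof -
    have "x \<noteq> []"
      using x W Nm by (auto simp: words_def)
    then obtain p b where p: "x = p @ [b]"
      by (cases x rule: rev_cases) auto
    with E[OF x] have "sum_list p = b"
      by (cases b; cases "sum_list p") auto
    with p show ?thesis by (simp add: append_parity_def)
  qed
  have C: "C = append_parity ` P"
    using ap by (force simp: P_def image_image)
  have dist: "3 \<le> hamming_dist p q" if pq: "p \<in> P" "q \<in> P" "p \<noteq> q" for p q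
  proof -
    have "append_parity p \<noteq> append_parity q"
      using pq by (auto simp: append_parity_def)
    then have "4 \<le> hamming_dist (append_parity p) (append_parity q)"
      using D pq C by blast
    then show ?thesis
      using pq lenP
      by (cases "sum_list p = sum_list q") (auto simp: append_parity_def hamming_dist_append)
  qed
  have cover: "\<exists>c\<in>P. hamming_dist w c \<le> 1" if w: "length w = m" for w
  proof -
    \<comment> \<open>The appended bit is the wrong parity of \<open>w\<close>, which makes the
      weight odd as \<open>V\<close> asks.\<close>
    have "\<exists>c\<in>C. hamming_dist (w @ [1 + sum_list w]) c \<le> 1"
      using w Nm by (intro V) (auto simp: ac_simps)
    then obtain c where c: "c \<in> P" "hamming_dist (w @ [1 + sum_list w]) (append_parity c) \<le> 1"
      using C by auto
    then have "hamming_dist w c \<le> 1"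
      using w lenP by (simp add: append_parity_def hamming_dist_append)
    with c show ?thesis by auto
  qed
  \<comment> \<open>Two changes lead from \<open>x\<close> to \<open>v\<close>. A codeword within 1
    of \<open>v\<close> cannot be \<open>x\<close>, and by the triangle inequality its distance from
    \<open>x\<close> is at most 3.\<close>
  have attained: "\<exists>x\<in>P. \<exists>y\<in>P. x \<noteq> y \<and> hamming_dist x y = 3" if "x \<in> P" for x
  proof -
    obtain a b xs where x: "x = a # b # xs"
      using m2 lenP[OF \<open>x \<in> P\<close>] by (cases x; cases "tl x") auto
    define v where "v = (a + 1) # (b + 1) # xs"
    have v: "length v = m" "hamming_dist x v = 2"
      using lenP[OF that] x by (auto simp: v_def hamming_dist_eq_0_iff)
    obtain c where c: "c \<in> P" "hamming_dist v c \<le> 1"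
      using cover v by auto
    have "c \<noteq> x"
      using c v lenP by (auto simp: hamming_dist_commute)
    moreover from this have "3 \<le> hamming_dist x c"
      using dist c that by auto
    moreover have "hamming_dist x c \<le> 3"
      using hamming_dist_triangle[of x v c] c v lenP that by auto
    ultimately show ?thesis
      using c that by (metis le_antisym)
  qed
  have unique: "c = d" if "c \<in> P" "d \<in> P" "length v = m"
    "hamming_dist v c \<le> 1" "hamming_dist v d \<le> 1" for v c d
  proof (rule ccontr)
    assume "c \<noteq> d"
    then have "3 \<le> hamming_dist c d"
      using dist that by auto
    moreover have "hamming_dist c d \<le> hamming_dist v c + hamming_dist v d"
      using hamming_dist_triangle[of c v d] that lenP by (auto simp: hamming_dist_commute)
    ultimately show False
      using that by simp
  qed
  have "perfect_code m P"
    unfolding perfect_code_def has_min_distance_def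
  proof (intro conjI ballI impI)
    show "P \<subseteq> words UNIV m"
      using lenP by (auto simp: words_def)
    show "\<exists>!c. c \<in> P \<and> hamming_dist v c \<le> 1" if "v \<in> words UNIV m" for v
      using that cover[of v] unique[of _ _ v] by (auto simp: words_def)
  qed (use dist attained in blast)+
  with C Nm show ?thesis
    unfolding extended_perfect_code_def by blast
qed

subsection \<open>Parities and labels of the blocks\<close>

text \<open>The last position of a block has label \<open>0\<close> and so does not contribute to the label of
  the block. The labels form the Klein four-group under \<open>XOR\<close>, which is \<open>F\<^sub>2\<^sup>4\<close> modulo
  \<open>C\<^sub>0\<close> and \<open>e\<^sub>0\<close>.\<close>

definition block_label :: "bit \<Rightarrow> bit \<Rightarrow> bit \<Rightarrow> nat" where
  "block_label p q r =
     (if p = 1 then 1 else 0) XOR (if q = 1 then 2 else 0) XOR (if r = 1 then 3 else 0)"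

fun parities :: "bit list \<Rightarrow> bit list" where
  "parities (p # q # r # s # x) = (p + q + r + s) # parities x"
| "parities _ = []"

fun labels :: "bit list \<Rightarrow> nat list" where
  "labels (p # q # r # s # x) = block_label p q r # labels x"
| "labels _ = []"

lemma E4_xor: "a \<in> E4 \<Longrightarrow> b \<in> E4 \<Longrightarrow> a XOR b \<in> E4"
  by (auto simp: E4_def)

lemma block_label_E4: "block_label p q r \<in> E4"
  by (cases p; cases q; cases r) (simp_all add: block_label_def E4_def)

lemma block_label_add:
  "block_label (p + p') (q + q') (r + r') = block_label p q r XOR block_label p' q' r'"
  by (cases p; cases q; cases r; cases p'; cases q'; cases r') (simp_all add: block_label_def)

section \<open>Parities and labels along the blocks of a word\<close>

lemma block_induct [consumes 1, case_names Nil block]: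
  assumes "length x = 4 * n"
    and "P 0 []"
    and "\<And>n p q r s x. length x = 4 * n \<Longrightarrow> P n x \<Longrightarrow> P (Suc n) (p # q # r # s # x)"
  shows "P n x"
  using assms(1)
proof (induction n arbitrary: x)
  case (Suc n)
  then obtain p q r s y where "x = p # q # r # s # y" "length y = 4 * n"
    by (auto simp: length_Suc_conv numeral_eq_Suc)
  with Suc.IH assms(3) show ?case by blast
qed (use assms(2) in auto)

lemma block_induct2 [consumes 2, case_names Nil block]:
  assumes "length x = 4 * n" "length x' = 4 * n"
    and "P 0 [] []"
    and "\<And>n p q r s x p' q' r' s' x'. length x = 4 * n \<Longrightarrow> length x' = 4 * n \<Longrightarrow> P n x x' \<Longrightarrow>
      P (Suc n) (p # q # r # s # x) (p' # q' # r' # s' # x')"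
  shows "P n x x'"
  using assms(1,2)
proof (induction x arbitrary: x' rule: block_induct)
  case (block n p q r s x)
  then obtain p' q' r' s' y' where "x' = p' # q' # r' # s' # y'" "length y' = 4 * n"
    by (auto simp: length_Suc_conv numeral_eq_Suc)
  with block assms(4) show ?case by blast
qed (use assms(3) in auto)

lemma length_parities: "length x = 4 * n \<Longrightarrow> length (parities x) = n"
  by (induction rule: block_induct) simp_all

lemma length_labels: "length x = 4 * n \<Longrightarrow> length (labels x) = n"
  by (induction rule: block_induct) simp_all

lemma set_labels: "length x = 4 * n \<Longrightarrow> set (labels x) \<subseteq> E4"
  by (induction rule: block_induct) (simp_all add: block_label_E4)

lemma sum_list_parities: "length x = 4 * n \<Longrightarrow> sum_list (parities x) = sum_list x"
  by (induction rule: block_induct) (simp_all add: ac_simps)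

lemma nth_parities:
  "length x = 4 * n \<Longrightarrow> i < n \<Longrightarrow>
    parities x ! i = x ! (4 * i) + x ! (4 * i + 1) + x ! (4 * i + 2) + x ! (4 * i + 3)"
proof (induction arbitrary: i rule: block_induct)
  case (block n p q r s x)
  then show ?case by (cases i) (simp_all add: numeral_eq_Suc)
qed simp

lemma nth_labels:
  "length x = 4 * n \<Longrightarrow> i < n \<Longrightarrow>
    labels x ! i = block_label (x ! (4 * i)) (x ! (4 * i + 1)) (x ! (4 * i + 2))"
proof (induction arbitrary: i rule: block_induct)
  case (block n p q r s x)
  then show ?case by (cases i) (simp_all add: numeral_eq_Suc)
qed simp

lemma vadd_Cons [simp]: "vadd (a # x) (b # y) = (a + b) # vadd x y"
  and vadd_Nil [simp]: "vadd [] y = []"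
  by (simp_all add: vadd_def)

lemma length_vadd [simp]: "length (vadd x y) = min (length x) (length y)"
  by (simp add: vadd_def)

lemma parities_vadd:
  "length x = 4 * n \<Longrightarrow> length y = 4 * n \<Longrightarrow>
    parities (vadd x y) = vadd (parities x) (parities y)"
  by (induction rule: block_induct2) (simp_all add: ac_simps)

lemma labels_vadd:
  "length x = 4 * n \<Longrightarrow> length y = 4 * n \<Longrightarrow>
    labels (vadd x y) = map2 (XOR) (labels x) (labels y)"
  by (induction rule: block_induct2) (simp_all add: block_label_add)

section \<open>Distances between words in terms of parities and labels\<close>

lemma block_dist_parities:
  "p + q + r + s \<noteq> p' + q' + r' + (s'::bit) \<Longrightarrow>
    Suc 0 \<le> of_bool (p \<noteq> p') + of_bool (q \<noteq> q') + of_bool (r \<noteq> r') + of_bool (s \<noteq> s')"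
  by (cases "p = p'"; cases "q = q'"; cases "r = r'"; cases "s = s'") auto

text \<open>Equal parities force an even number of differences, and zero differences would give
  equal labels. The sum of \<open>of_bool\<close> terms is what \<open>hamming_dist\<close> unfolds
  to on one block.\<close>

lemma block_dist_labels:
  "p + q + r + s = p' + q' + r' + (s'::bit) \<Longrightarrow> block_label p q r \<noteq> block_label p' q' r' \<Longrightarrow>
    2 \<le> of_bool (p \<noteq> p') + of_bool (q \<noteq> q') + of_bool (r \<noteq> r') + (of_bool (s \<noteq> s') :: nat)"
  by (cases p; cases q; cases r; cases s; cases p'; cases q'; cases r'; cases s')
    (simp_all add: block_label_def)

text \<open>The sum of the two blocks has parity 0 and label 0, hence is one of the two words of
  \<open>repetition_code\<close>.\<close>

lemma block_dist_eq_labels: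
  "p + q + r + s = p' + q' + r' + (s'::bit) \<Longrightarrow> block_label p q r = block_label p' q' r' \<Longrightarrow>
    [p, q, r, s] = [p', q', r', s'] \<or> p \<noteq> p' \<and> q \<noteq> q' \<and> r \<noteq> r' \<and> s \<noteq> s'"
  by (cases p; cases q; cases r; cases s; cases p'; cases q'; cases r'; cases s')
    (simp_all add: block_label_def)

lemma hamming_dist_parities_le:
  "length x = 4 * n \<Longrightarrow> length y = 4 * n \<Longrightarrow>
    hamming_dist (parities x) (parities y) \<le> hamming_dist x y"
proof (induction rule: block_induct2)
  case (block n p q r s x p' q' r' s' y)
  then show ?case
    using block_dist_parities[of p q r s p' q' r' s'] by (auto simp: of_bool_def)
qed simp

lemma hamming_dist_labels_le:
  "length x = 4 * n \<Longrightarrow> length y = 4 * n \<Longrightarrow> parities x = parities y \<Longrightarrow>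
    2 * hamming_dist (labels x) (labels y) \<le> hamming_dist x y"
proof (induction rule: block_induct2)
  case (block n p q r s x p' q' r' s' y)
  then show ?case
    using block_dist_labels[of p q r s p' q' r' s']
    by (cases "block_label p q r = block_label p' q' r'") auto
qed simp

lemma hamming_dist_same_labels:
  "length x = 4 * n \<Longrightarrow> length y = 4 * n \<Longrightarrow> parities x = parities y \<Longrightarrow> labels x = labels y \<Longrightarrow>
    x \<noteq> y \<Longrightarrow> 4 \<le> hamming_dist x y"
proof (induction rule: block_induct2)
  case (block n p q r s x p' q' r' s' y)
  then show ?case
    using block_dist_eq_labels[of p q r s p' q' r' s'] by auto
qed simp

section \<open>Membership in the cosets and in the concatenated code\<close>

lemma unit_vec_simps:
  "unit_vec 0 = [0, 0, 0, 1]" "unit_vec 1 = [1, 0, 0, 0]"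
  "unit_vec 2 = [0, 1, 0, 0]" "unit_vec 3 = [0, 0, 1, 0]"
  by (simp_all add: unit_vec_def numeral_eq_Suc)

text \<open>Words of \<open>repetition_code\<close> have parity 0 and label \<open>0\<close>, as
  \<open>1 XOR 2 XOR 3 = 0\<close>. The \<open>unit_vec 0\<close> term adds parity
  \<open>1 + h\<close> and no label, and \<open>unit_vec a\<close> adds parity 1 and label
  \<open>a\<close>. Parity and label together determine a block up to
  \<open>repetition_code\<close>.\<close>

lemma coset_code_iff:
  assumes "a \<in> E4"
  shows "[p, q, r, s] \<in> coset_code h a \<longleftrightarrow> p + q + r + s = h \<and> block_label p q r = a"
  using assms unfolding E4_def
  by (elim insertE emptyE; cases p; cases q; cases r; cases s; cases h;
      simp add: coset_code_def repetition_code_def unit_vec_simps[simplified] vscale_def block_label_def)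

lemma length_coset_code: "w \<in> coset_code h a \<Longrightarrow> length w = 4"
  by (auto simp: coset_code_def repetition_code_def unit_vec_def vscale_def)

text \<open>The length is recorded separately because \<open>parities\<close> and
  \<open>labels\<close> drop an incomplete last block.\<close>

lemma concat_listset_iff:
  "length h = length a \<Longrightarrow> set a \<subseteq> E4 \<Longrightarrow>
    x \<in> concat ` listset (map2 coset_code h a) \<longleftrightarrow>
      length x = 4 * length a \<and> parities x = h \<and> labels x = a"
proof (induction h a arbitrary: x rule: list_induct2)
  case (Cons h hs a as)
  have a: "a \<in> E4"
    using Cons.prems by simp
  have "x \<in> concat ` listset (map2 coset_code (h # hs) (a # as)) \<longleftrightarrow>
      (\<exists>w y. x = w @ y \<and> w \<in> coset_code h a \<and> y \<in> concat ` listset (map2 coset_code hs as))"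
    by (force simp: set_Cons_def image_iff)
  also have "\<dots> \<longleftrightarrow> (\<exists>w y. x = w @ y \<and> w \<in> coset_code h a \<and>
      length y = 4 * length as \<and> parities y = hs \<and> labels y = as)"
    using Cons.IH Cons.prems by simp
  \<comment> \<open>Coset words have length 4, so the first block can be named bit by bit; this lets
    \<open>parities\<close> and \<open>labels\<close> compute.\<close>
  also have "\<dots> \<longleftrightarrow> (\<exists>p q r s y. x = p # q # r # s # y \<and> [p, q, r, s] \<in> coset_code h a \<and>
      length y = 4 * length as \<and> parities y = hs \<and> labels y = as)" (is "?L \<longleftrightarrow> ?R")
  proof
    assume ?L
    then obtain w y where wy: "x = w @ y" "w \<in> coset_code h a"
      "length y = 4 * length as \<and> parities y = hs \<and> labels y = as"
      by blast
    then obtain p q r s where "w = [p, q, r, s]"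
      using length_coset_code[of w h a] by (auto simp: length_Suc_conv numeral_eq_Suc)
    with wy show ?R by auto
  next
    assume ?R
    then obtain p q r s y where "x = [p, q, r, s] @ y" "[p, q, r, s] \<in> coset_code h a"
      "length y = 4 * length as \<and> parities y = hs \<and> labels y = as"
      by auto
    then show ?L by blast
  qed
  also have "\<dots> \<longleftrightarrow> length x = 4 * length (a # as) \<and> parities x = h # hs \<and> labels x = a # as"
    (is "?L \<longleftrightarrow> ?R")
  proof
    assume ?L
    then show ?R
      using coset_code_iff[OF a] by auto
  next
    assume R: ?R
    then obtain p q r s y where "x = p # q # r # s # y"
      by (auto simp: length_Suc_conv numeral_eq_Suc)
    with R show ?L
      using coset_code_iff[OF a] by auto
  qed
  finally show ?case .
qed auto

lemma concat_code_iff: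
  assumes "H \<subseteq> words UNIV n" "M \<subseteq> words E4 n"
  shows "x \<in> concat_code H M \<longleftrightarrow> length x = 4 * n \<and> parities x \<in> H \<and> labels x \<in> M"
proof -
  have "x \<in> concat ` listset (map2 coset_code h a) \<longleftrightarrow>
      length x = 4 * n \<and> parities x = h \<and> labels x = a" if "h \<in> H" "a \<in> M" for h a
    using that assms concat_listset_iff[of h a x] by (force simp: words_def)
  then show ?thesis
    by (auto simp: concat_code_def)
qed


subsection \<open>Quaternary MDS codes\<close>

lemma hamming_dist_le_1:
  assumes "\<And>j. j < length x \<Longrightarrow> j \<noteq> i \<Longrightarrow> x ! j = y ! j"
  shows "hamming_dist x y \<le> 1"
proof -
  have "{j. j < length x \<and> x ! j \<noteq> y ! j} \<subseteq> {i}"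
    using assms by auto
  from card_mono[OF _ this] show ?thesis
    by (simp add: hamming_dist_def)
qed

lemma hamming_dist_eq_1E:
  assumes "hamming_dist x y = 1"
  obtains i where "i < length x" "x ! i \<noteq> y ! i"
    "\<And>j. j < length x \<Longrightarrow> j \<noteq> i \<Longrightarrow> x ! j = y ! j"
proof -
  obtain i where "{j. j < length x \<and> x ! j \<noteq> y ! j} = {i}"
    using assms unfolding hamming_dist_def by (rule card_1_singletonE)
  then show ?thesis
    by (intro that[of i]) auto
qed

text \<open>No two codewords differ in coordinate \<open>i\<close> alone, so deleting it is
  injective on \<open>M\<close>. The \<open>4 ^ (n - 1)\<close> images then exhaust the shorter
  words, among them the one obtained from \<open>u\<close>.\<close>

lemma quaternary_mds_complete:
  assumes M: "quaternary_mds n M" and i: "i < n" and u: "u \<in> words E4 n"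
  obtains a where "a \<in> M" "\<And>j. j < n \<Longrightarrow> j \<noteq> i \<Longrightarrow> a ! j = u ! j"
proof -
  define f where "f a = take i a @ drop (Suc i) a" for a :: "nat list"
  have agree: "a ! j = b ! j"
    if "f a = f b" "length a = n" "length b = n" "j < n" "j \<noteq> i" for a b j
  proof (cases "j < i")
    case True
    have "take i a = take i b"
      using that i by (simp add: f_def)
    then show ?thesis
      using True by (metis nth_take)
  next
    case False
    have "drop (Suc i) a = drop (Suc i) b"
      using that i by (simp add: f_def)
    then have "drop (Suc i) a ! (j - Suc i) = drop (Suc i) b ! (j - Suc i)"
      by simp
    then show ?thesis
      using False that i by simp
  qed
  have MW: "M \<subseteq> words E4 n" and card_M: "card M = 4 ^ (n - 1)"
    and dist: "\<And>a b. a \<in> M \<Longrightarrow> b \<in> M \<Longrightarrow> a \<noteq> b \<Longrightarrow> 2 \<le> hamming_dist a b"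
    using M by (auto simp: quaternary_mds_def has_min_distance_def)
  have inj: "inj_on f M"
  proof (rule inj_onI, rule ccontr)
    fix a b assume ab: "a \<in> M" "b \<in> M" "f a = f b" "a \<noteq> b"
    have "hamming_dist a b \<le> 1"
    proof (rule hamming_dist_le_1)
      show "a ! j = b ! j" if "j < length a" "j \<noteq> i" for j
        using ab MW that by (intro agree) (auto simp: words_def)
    qed
    with dist[OF ab(1,2,4)] show False by simp
  qed
  have f_words: "f a \<in> words E4 (n - 1)" if "a \<in> words E4 n" for a
    using that i set_take_subset[of i a] set_drop_subset[of "Suc i" a]
    by (auto simp: f_def words_def)
  have "finite E4" "card E4 = 4"
    by (simp_all add: E4_def)
  then have "card (words E4 (n - 1)) = 4 ^ (n - 1)" and fin: "finite (words E4 (n - 1))"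
    using card_lists_length_eq[of E4 "n - 1"] finite_lists_length_eq[of E4 "n - 1"]
    by (simp_all add: words_def)
  then have "f ` M = words E4 (n - 1)"
    using inj f_words MW card_M by (intro card_subset_eq) (auto simp: card_image)
  then obtain a where a: "a \<in> M" "f a = f u"
    using f_words[OF u] by (metis imageE)
  show ?thesis
    by (rule that[OF a(1)]) (use agree[OF a(2)] a(1) MW u in \<open>auto simp: words_def\<close>)
qed

subsection \<open>Coordinate permutations from permutations of the labels\<close>

text \<open>A permutation of \<open>E\<^sub>4\<close> is affine for \<open>XOR\<close>, since the sum of all four labels
  vanishes. Its linear part fixes the label \<open>0\<close>, so that moving the positions of a block by it
  respects the decomposition into the cosets \<open>C\<^sub>a\<^sup>r\<close> for both parities.\<close>

definition linear_part :: "(nat \<Rightarrow> nat) \<Rightarrow> nat \<Rightarrow> nat" where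
  "linear_part s a = s a XOR s 0"

lemma nat_xor_cancel [simp]: "a XOR a XOR b = (b :: nat)"
  by (simp flip: xor.assoc)

lemma permutes_E4_affine:
  assumes s: "s permutes E4" and a: "a \<in> E4" and b: "b \<in> E4"
  shows "s (a XOR b) = s a XOR s b XOR s 0"
proof -
  have "s 0 \<in> E4" "s 1 \<in> E4" "s 2 \<in> E4" "s 3 \<in> E4"
    using permutes_in_image[OF s] by (auto simp: E4_def)
  moreover have "s 0 \<noteq> s 1" "s 0 \<noteq> s 2" "s 0 \<noteq> s 3" "s 1 \<noteq> s 2" "s 1 \<noteq> s 3" "s 2 \<noteq> s 3"
    using permutes_inj[OF s] by (auto simp: inj_eq)
  \<comment> \<open>The four values are distinct, so they exhaust \<open>E4\<close>, whose elements
    have \<open>XOR\<close> equal to \<open>0\<close>.\<close>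
  ultimately have s3: "s 3 = s 0 XOR s 1 XOR s 2"
    unfolding E4_def by (elim insertE emptyE) simp_all
  from a b show ?thesis
    unfolding E4_def by (elim insertE emptyE) (simp_all add: s3 ac_simps)
qed


lemma linear_part_0 [simp]: "linear_part s 0 = 0"
  by (simp add: linear_part_def)

lemma linear_part_E4: "s permutes E4 \<Longrightarrow> a \<in> E4 \<Longrightarrow> linear_part s a \<in> E4"
  unfolding linear_part_def by (intro E4_xor) (simp_all add: permutes_in_image, simp add: E4_def)

lemma linear_part_inj:
  assumes "s permutes E4" "linear_part s a = linear_part s b"
  shows "a = b"
proof -
  have "s a = linear_part s a XOR s 0" "s b = linear_part s b XOR s 0"
    by (simp_all add: linear_part_def ac_simps)
  then have "s a = s b"
    using assms(2) by simp
  then show ?thesis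
    using permutes_inj[OF assms(1)] by (simp add: inj_eq)
qed

text \<open>Since \<open>s\<close> is affine, the difference \<open>s (t a) XOR s (t 0)\<close>
  depends only on \<open>t a XOR t 0\<close>; the translations drop out.\<close>

lemma linear_part_comp:
  assumes "s permutes E4" "t permutes E4" "a \<in> E4"
  shows "linear_part (s \<circ> t) a = linear_part s (linear_part t a)"
proof -
  have "t a \<in> E4" "t 0 \<in> E4"
    using assms permutes_in_image[of t E4] by (auto simp: E4_def)
  then show ?thesis
    using permutes_E4_affine[OF assms(1), of "t a" "t 0"] by (simp add: linear_part_def ac_simps)
qed

text \<open>The index, counted from 0, of the position labelled \<open>a\<close>: label
  \<open>0\<close> goes to 3 and any other \<open>a\<close> to \<open>a - 1\<close>, in a single
  formula.\<close>

definition label_pos :: "nat \<Rightarrow> nat" where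
  "label_pos a = (a + 3) mod 4"

text \<open>Here \<open>(k mod 4 + 1) mod 4\<close> turns an index within a block back into its
  label. Beyond the word the map is the identity, as \<open>permutes\<close> demands.\<close>

definition block_perm :: "(nat \<Rightarrow> nat) list \<Rightarrow> nat \<Rightarrow> nat" where
  "block_perm ss k =
     (if k < 4 * length ss
      then 4 * (k div 4) + label_pos (linear_part (ss ! (k div 4)) ((k mod 4 + 1) mod 4))
      else k)"

lemma label_pos_less [simp]: "label_pos a < 4"
  by (simp add: label_pos_def)

lemma label_pos_simps [simp]:
  "label_pos 0 = 3" "label_pos (Suc 0) = 0"
  "label_pos (Suc (Suc 0)) = 1" "label_pos (Suc (Suc (Suc 0))) = 2"
  "label_pos 2 = 1" "label_pos 3 = 2"
  by (simp_all add: label_pos_def)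

lemma label_pos_inj: "a \<in> E4 \<Longrightarrow> b \<in> E4 \<Longrightarrow> label_pos a = label_pos b \<Longrightarrow> a = b"
  by (auto simp: E4_def)

lemma block_position_cases:
  assumes "k < 4 * n"
  obtains i a where "i < n" "a \<in> E4" "k = 4 * i + label_pos a"
proof
  show "k div 4 < n"
    using assms by auto
  have "k mod 4 \<in> {0, 1, 2, 3}"
    by auto
  then have "(k mod 4 + 1) mod 4 \<in> E4 \<and> label_pos ((k mod 4 + 1) mod 4) = k mod 4"
    unfolding E4_def by (elim insertE emptyE) simp_all
  then show "(k mod 4 + 1) mod 4 \<in> E4" "k = 4 * (k div 4) + label_pos ((k mod 4 + 1) mod 4)"
    by simp_all
qed

lemma block_position_less: "i < n \<Longrightarrow> 4 * i + label_pos a < 4 * n"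
  using label_pos_less[of a] by linarith

lemma block_perm_position:
  assumes "i < length ss" "a \<in> E4"
  shows "block_perm ss (4 * i + label_pos a) = 4 * i + label_pos (linear_part (ss ! i) a)"
proof -
  have "(label_pos a + 1) mod 4 = a"
    using assms(2) unfolding E4_def by (elim insertE emptyE) simp_all
  then show ?thesis
    using block_position_less[OF assms(1), of a] by (simp add: block_perm_def)
qed

lemma block_position_eq_iff:
  assumes "a \<in> E4" "b \<in> E4"
  shows "4 * i + label_pos a = 4 * j + label_pos b \<longleftrightarrow> i = j \<and> a = b"
proof
  assume eq: "4 * i + label_pos a = 4 * j + label_pos b"
  then have "i = j"
    using label_pos_less[of a] label_pos_less[of b] by linarith
  with eq show "i = j \<and> a = b"
    using label_pos_inj[OF assms] by simp
qed simp

lemma block_perm_permutes: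
  assumes "multiperm n ss"
  shows "block_perm ss permutes {..<4 * n}"
proof (rule bij_imp_permutes)
  have len: "length ss = n" and perm: "\<And>i. i < n \<Longrightarrow> ss ! i permutes E4"
    using assms by (auto simp: multiperm_def)
  have "inj_on (block_perm ss) {..<4 * n}"
  proof (rule inj_onI)
    fix k l assume "k \<in> {..<4 * n}" "l \<in> {..<4 * n}" and eq: "block_perm ss k = block_perm ss l"
    then obtain i a j b where k: "i < n" "a \<in> E4" "k = 4 * i + label_pos a"
      and l: "j < n" "b \<in> E4" "l = 4 * j + label_pos b"
      by (metis lessThan_iff block_position_cases)
    have "i = j \<and> linear_part (ss ! i) a = linear_part (ss ! j) b"
      using eq k l len perm by (auto simp: block_perm_position block_position_eq_iff linear_part_E4)
    then show "k = l"
      using k l linear_part_inj[OF perm[OF k(1)], of a b] by auto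
  qed
  moreover have "block_perm ss ` {..<4 * n} \<subseteq> {..<4 * n}"
  proof (rule image_subsetI)
    fix k assume "k \<in> {..<4 * n}"
    then obtain i a where "i < n" "a \<in> E4" "k = 4 * i + label_pos a"
      by (metis lessThan_iff block_position_cases)
    then show "block_perm ss k \<in> {..<4 * n}"
      using len by (simp add: block_perm_position block_position_less)
  qed
  ultimately show "bij_betw (block_perm ss) {..<4 * n} {..<4 * n}"
    by (simp add: bij_betw_def endo_inj_surj)
  show "block_perm ss k = k" if "k \<notin> {..<4 * n}" for k
    using that len by (simp add: block_perm_def)
qed

text \<open>Only linear parts enter, and they compose; this turns the composition law for
  \<open>\<sigma>\<close> into the one for coordinate permutations.\<close>

lemma block_perm_comp:
  assumes "multiperm n ss" "multiperm n ts"
  shows "block_perm (multiperm_comp ss ts) = block_perm ss \<circ> block_perm ts"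
proof
  fix k
  have len: "length ss = n" "length ts = n" "length (multiperm_comp ss ts) = n"
    and perm: "\<And>i. i < n \<Longrightarrow> ss ! i permutes E4" "\<And>i. i < n \<Longrightarrow> ts ! i permutes E4"
    using assms by (auto simp: multiperm_def multiperm_comp_def)
  show "block_perm (multiperm_comp ss ts) k = (block_perm ss \<circ> block_perm ts) k"
  proof (cases "k < 4 * n")
    case True
    then obtain i a where k: "i < n" "a \<in> E4" "k = 4 * i + label_pos a"
      by (rule block_position_cases)
    moreover have "multiperm_comp ss ts ! i = ss ! i \<circ> ts ! i"
      using k len by (simp add: multiperm_comp_def)
    ultimately show ?thesis
      using len perm by (simp add: block_perm_position linear_part_E4 linear_part_comp)
  next
    case False
    then show ?thesis
      using len by (simp add: block_perm_def)
  qed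
qed

text \<open>The block \<open>w\<close> arises from \<open>v\<close> by moving each bit along the
  linear part. Linearity carries the \<open>XOR\<close> of the labels of the ones along, and the
  number of ones does not change.\<close>

lemma block_permuted:
  fixes v w :: "nat \<Rightarrow> bit"
  assumes s: "s permutes E4"
    and w: "\<And>a. a \<in> E4 \<Longrightarrow> w (label_pos (linear_part s a)) = v (label_pos a)"
  shows "block_label (w 0) (w 1) (w 2) = linear_part s (block_label (v 0) (v 1) (v 2))"
    and "w 0 + w 1 + w 2 + w 3 = v 0 + v 1 + v 2 + v 3"
proof -
  let ?L = "linear_part s"
  have inj: "?L a = ?L b \<longleftrightarrow> a = b" for a b
    using linear_part_inj[OF s] by blast
  have L: "?L 1 \<in> E4" "?L 2 \<in> E4" "?L 3 \<in> E4"
    by (rule linear_part_E4[OF s], simp add: E4_def)+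
  have "?L 1 \<noteq> ?L 0" "?L 2 \<noteq> ?L 0" "?L 3 \<noteq> ?L 0" "?L 1 \<noteq> ?L 2" "?L 1 \<noteq> ?L 3" "?L 2 \<noteq> ?L 3"
    unfolding inj by simp_all
  \<comment> \<open>Fixing \<open>0\<close>, the linear part is one of the six permutations of 1, 2,
    3; both claims are then checked for each.\<close>
  with L have cases: "(?L 1, ?L 2, ?L 3) \<in>
      {(1, 2, 3), (1, 3, 2), (2, 1, 3), (2, 3, 1), (3, 1, 2), (3, 2, 1)}"
    unfolding E4_def by (elim insertE emptyE) simp_all
  have eqs: "w (label_pos (?L 0)) = v 3" "w (label_pos (?L 1)) = v 0" "w (label_pos (?L 2)) = v 1"
    "w (label_pos (?L 3)) = v 2"
    using w[of 0] w[of 1] w[of 2] w[of 3] by (simp_all add: E4_def)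
  show "block_label (w 0) (w 1) (w 2) = ?L (block_label (v 0) (v 1) (v 2))"
    using cases eqs
    by (cases "v 0"; cases "v 1"; cases "v 2") (auto simp: block_label_def)
  show "w 0 + w 1 + w 2 + w 3 = v 0 + v 1 + v 2 + v 3"
    using cases eqs by (auto simp: ac_simps)
qed

lemma length_perm_act [simp]: "length (perm_act p x) = length x"
  by (simp add: perm_act_def)

lemma perm_act_nth:
  assumes "p permutes {..<length x}" "k < length x"
  shows "perm_act p x ! p k = x ! k"
  using assms permutes_in_image[OF assms(1), of k]
  by (simp add: perm_act_def permute_list_nth permutes_inv permutes_inverses)

text \<open>No bit leaves its block, so \<open>block_permuted\<close> applies to each block in
  turn.\<close>

lemma
  assumes ss: "multiperm n ss" and x: "length x = 4 * n"
  shows parities_block_perm: "parities (perm_act (block_perm ss) x) = parities x"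
    and labels_block_perm:
      "labels (perm_act (block_perm ss) x) = map2 linear_part ss (labels x)"
proof -
  let ?y = "perm_act (block_perm ss) x"
  have len: "length ss = n" "length ?y = 4 * n" and perm: "\<And>i. i < n \<Longrightarrow> ss ! i permutes E4"
    using ss x by (auto simp: multiperm_def)
  have act: "?y ! (4 * i + label_pos (linear_part (ss ! i) a)) = x ! (4 * i + label_pos a)"
    if "i < n" "a \<in> E4" for i a
    using perm_act_nth[of "block_perm ss" x "4 * i + label_pos a"] that
      block_perm_permutes[OF ss] x len by (simp add: block_perm_position block_position_less)
  show "parities ?y = parities x"
  proof (rule nth_equalityI)
    show "parities ?y ! i = parities x ! i" if "i < length (parities ?y)" for i
    proof -
      have i: "i < n"
        using that len length_parities by simp
      show ?thesis
        using block_permuted(2)[of "ss ! i" "\<lambda>j. ?y ! (4 * i + j)" "\<lambda>j. x ! (4 * i + j)",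
            OF perm[OF i] act[OF i]] i len x by (simp add: nth_parities)
    qed
  qed (simp add: length_parities[OF len(2)] length_parities[OF x])
  show "labels ?y = map2 linear_part ss (labels x)"
  proof (rule nth_equalityI)
    show "labels ?y ! i = map2 linear_part ss (labels x) ! i" if "i < length (labels ?y)" for i
    proof -
      have i: "i < n"
        using that len length_labels by simp
      show ?thesis
        using block_permuted(1)[of "ss ! i" "\<lambda>j. ?y ! (4 * i + j)" "\<lambda>j. x ! (4 * i + j)",
            OF perm[OF i] act[OF i]] i len x length_labels[OF x]
        by (simp add: nth_labels)
    qed
  qed (simp add: length_labels[OF len(2)] length_labels[OF x] len)
qed

subsection \<open>The concatenated code\<close>

text \<open>This lets a single flip repair parity and label at once: every flip changes the parity,
  while the choice of position sets the change of label. For \<open>t = 0\<close> the last position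
  is flipped, which keeps the label.\<close>

lemma
  assumes x: "length x = 4 * n" and i: "i < n" and t: "t \<in> E4"
  defines "y \<equiv> x[4 * i + label_pos t := x ! (4 * i + label_pos t) + 1]"
  shows parities_flip: "parities y = (parities x)[i := parities x ! i + 1]"
    and labels_flip: "labels y = (labels x)[i := labels x ! i XOR t]"
proof -
  have y: "length y = 4 * n"
    by (simp add: y_def x)
  have y_nth: "y ! (4 * j + label_pos a) =
      (if i = j \<and> t = a then x ! (4 * j + label_pos a) + 1 else x ! (4 * j + label_pos a))"
    if "j < n" "a \<in> E4" for j a
    using block_position_eq_iff[OF t that(2), of i j] block_position_less[OF that(1), of a] x
    by (auto simp: y_def)
  \<comment> \<open>The previous fact with \<open>label_pos\<close> evaluated, in the shape of
    \<open>nth_parities\<close> and \<open>nth_labels\<close>: indices 0, 1, 2, 3 carry labels 1, 2,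
    3, 0.\<close>
  have y_nths: "y ! (4 * j) = (if i = j \<and> t = 1 then x ! (4 * j) + 1 else x ! (4 * j))"
    "y ! (4 * j + 1) = (if i = j \<and> t = 2 then x ! (4 * j + 1) + 1 else x ! (4 * j + 1))"
    "y ! (4 * j + 2) = (if i = j \<and> t = 3 then x ! (4 * j + 2) + 1 else x ! (4 * j + 2))"
    "y ! (4 * j + 3) = (if i = j \<and> t = 0 then x ! (4 * j + 3) + 1 else x ! (4 * j + 3))"
    if "j < n" for j
    using y_nth[OF that, of 1] y_nth[OF that, of 2] y_nth[OF that, of 3] y_nth[OF that, of 0]
    by (simp_all add: E4_def)
  show "parities y = (parities x)[i := parities x ! i + 1]"
  proof (rule nth_equalityI)
    fix j assume "j < length (parities y)"
    then have "j < n"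
      using length_parities[OF y] by simp
    then show "parities y ! j = (parities x)[i := parities x ! i + 1] ! j"
      using t length_parities[OF x] unfolding nth_parities[OF y \<open>j < n\<close>] y_nths[OF \<open>j < n\<close>]
      by (auto simp: nth_list_update nth_parities[OF x] E4_def ac_simps)
  qed (simp add: length_parities[OF y] length_parities[OF x])
  have flip: "block_label (if t = 1 then p + 1 else p) (if t = 2 then q + 1 else q)
      (if t = 3 then r + 1 else r) = block_label p q r XOR t" for p q r
    using t unfolding E4_def
    by (elim insertE emptyE; cases p; cases q; cases r) (simp_all add: block_label_def)
  show "labels y = (labels x)[i := labels x ! i XOR t]"
  proof (rule nth_equalityI)
    fix j assume "j < length (labels y)"
    then have "j < n"
      using length_labels[OF y] by simp
    then show "labels y ! j = (labels x)[i := labels x ! i XOR t] ! j"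
      using length_labels[OF x] flip
      unfolding nth_labels[OF y \<open>j < n\<close>] y_nths[OF \<open>j < n\<close>]
      by (cases "i = j") (simp_all add: nth_labels[OF x])
  qed (simp add: length_labels[OF y] length_labels[OF x])
qed

section \<open>Distance and covering for the concatenated code\<close>

lemma concat_code_extended_perfect:
  assumes M: "quaternary_mds n M" and H: "extended_perfect_code n H"
  shows "extended_perfect_code (4 * n) (concat_code H M)"
proof (rule extended_perfect_codeI)
  have MW: "M \<subseteq> words E4 n" and n: "0 < n"
    and Mdist: "\<And>a b. a \<in> M \<Longrightarrow> b \<in> M \<Longrightarrow> a \<noteq> b \<Longrightarrow> 2 \<le> hamming_dist a b"
    using M by (auto simp: quaternary_mds_def has_min_distance_def)
  note HW = extended_perfect_code_words[OF H]
  note C = concat_code_iff[OF HW MW]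
  show "3 \<le> 4 * n" using n by simp
  show "concat_code H M \<subseteq> words UNIV (4 * n)"
    by (auto simp: C words_def)
  show "sum_list x = 0" if "x \<in> concat_code H M" for x
    using that extended_perfect_code_even[OF H] sum_list_parities[of x n] by (auto simp: C)
  show "4 \<le> hamming_dist x y" if "x \<in> concat_code H M" "y \<in> concat_code H M" "x \<noteq> y" for x y
  proof -
    have x: "length x = 4 * n" "parities x \<in> H" "labels x \<in> M"
      and y: "length y = 4 * n" "parities y \<in> H" "labels y \<in> M"
      using that by (auto simp: C)
    consider "parities x \<noteq> parities y" | "parities x = parities y" "labels x \<noteq> labels y"
      | "parities x = parities y" "labels x = labels y" by blast
    then show ?thesis
    proof cases
      case 1
      then show ?thesis
        using extended_perfect_code_dist[OF H x(2) y(2)] hamming_dist_parities_le[OF x(1) y(1)]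
        by simp
    next
      case 2
      then show ?thesis
        using Mdist[OF x(3) y(3)] hamming_dist_labels_le[OF x(1) y(1)] by simp
    next
      case 3
      then show ?thesis
        using hamming_dist_same_labels[OF x(1) y(1)] that(3) by simp
    qed
  qed
  show "\<exists>c\<in>concat_code H M. hamming_dist v c \<le> 1"
    if v: "length v = 4 * n" "sum_list v = 1" for v
  proof -
    have lens: "length (parities v) = n" "length (labels v) = n"
      using v length_parities length_labels by auto
    \<comment> \<open>The parities of \<open>v\<close> form an odd word, so they differ from some
      word of \<open>H\<close> in exactly one block.\<close>
    obtain h where h: "h \<in> H" "hamming_dist (parities v) h = 1"
      using extended_perfect_code_covers[OF H, of "parities v"] v lens sum_list_parities[OF v(1)]
      by auto
    then obtain i where i: "i < n" "parities v ! i \<noteq> h ! i"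
      "\<And>j. j < n \<Longrightarrow> j \<noteq> i \<Longrightarrow> parities v ! j = h ! j"
      using hamming_dist_eq_1E[OF h(2)] lens by metis
    have lv: "labels v \<in> words E4 n"
      using set_labels[OF v(1)] lens by (simp add: words_def)
    obtain a where a: "a \<in> M" "\<And>j. j < n \<Longrightarrow> j \<noteq> i \<Longrightarrow> a ! j = labels v ! j"
      using quaternary_mds_complete[OF M i(1) lv] by metis
    have lens': "length h = n" "length a = n" "a ! i \<in> E4" "labels v ! i \<in> E4"
      using h a HW MW lv i(1) by (auto simp: words_def subset_eq)
    \<comment> \<open>The label that must be added to block \<open>i\<close> to turn its present
      label into the one given by \<open>a\<close>; it selects the bit to flip.\<close>
    define t where "t = labels v ! i XOR a ! i"
    have t: "t \<in> E4"
      unfolding t_def using lens' by (intro E4_xor)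
    define c where "c = v[4 * i + label_pos t := v ! (4 * i + label_pos t) + 1]"
    have "h ! i = parities v ! i + 1"
      using i(2) by (cases "h ! i"; cases "parities v ! i") auto
    then have "parities c = h"
      unfolding c_def parities_flip[OF v(1) i(1) t]
      using i lens lens' by (intro nth_equalityI) (auto simp: nth_list_update)
    moreover have "labels c = a"
      unfolding c_def labels_flip[OF v(1) i(1) t]
      using i a lens lens' by (intro nth_equalityI) (auto simp: nth_list_update t_def)
    moreover have "length c = 4 * n"
      by (simp add: c_def v)
    ultimately have "c \<in> concat_code H M"
      using h a by (simp add: C)
    moreover have "hamming_dist v c \<le> 1"
      unfolding c_def using hamming_dist_update[of "4 * i + label_pos t" v]
        block_position_less[OF i(1), of t] v by simp
    ultimately show ?thesis by blast
  qed
qed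

section \<open>Propelinear structure on the concatenated code\<close>

lemma concat_code_propelinear:
  assumes M: "isotopic_propelinear n M" and H: "linear_code n H"
  shows "propelinear (4 * n) (concat_code H M)"
proof -
  obtain \<sigma> where MW: "M \<subseteq> words E4 n"
    and \<sigma>: "\<forall>a\<in>M. multiperm n (\<sigma> a) \<and> multiperm_apply (\<sigma> a) ` M = M \<and>
      multiperm_apply (\<sigma> a) (replicate n 0) = a"
    and comp: "\<forall>a\<in>M. \<forall>b\<in>M.
      \<sigma> (multiperm_apply (\<sigma> a) b) = multiperm_comp (\<sigma> a) (\<sigma> b)"
    using M by (auto simp only: isotopic_propelinear_def)
  from \<sigma> have perm: "\<And>a. a \<in> M \<Longrightarrow> multiperm n (\<sigma> a)"
    and img: "\<And>a. a \<in> M \<Longrightarrow> multiperm_apply (\<sigma> a) ` M = M"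
    and zero: "\<And>a. a \<in> M \<Longrightarrow> multiperm_apply (\<sigma> a) (replicate n 0) = a"
    by simp_all
  have HW: "H \<subseteq> words UNIV n" and Hadd: "\<And>x y. x \<in> H \<Longrightarrow> y \<in> H \<Longrightarrow> vadd x y \<in> H"
    using H by (auto simp: linear_code_def)
  note C = concat_code_iff[OF HW MW]
  \<comment> \<open>As \<open>\<pi> x\<close> depends on the labels of \<open>x\<close> alone, the
    composition law reduces to computing the labels of \<open>T x y\<close>.\<close>
  define \<pi> where "\<pi> x = block_perm (\<sigma> (labels x))" for x
  define T where "T x y = vadd x (perm_act (\<pi> x) y)" for x y
  have \<pi>: "\<pi> x permutes {..<4 * n}" if "x \<in> concat_code H M" for x
    using that block_perm_permutes perm by (simp add: \<pi>_def C)
  have labels_T: "labels (T x y) = multiperm_apply (\<sigma> (labels x)) (labels y)"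
    if "x \<in> concat_code H M" "y \<in> concat_code H M" for x y
  proof -
    have x: "length x = 4 * n" "labels x \<in> M" and y: "length y = 4 * n"
      using that by (auto simp: C)
    let ?s = "\<sigma> (labels x)"
    have len: "length ?s = n" "length (labels x) = n" "length (labels y) = n"
      using perm[OF x(2)] length_labels x y by (auto simp: multiperm_def)
    have s0: "labels x ! i = (?s ! i) 0" if "i < n" for i
    proof -
      have "labels x ! i = multiperm_apply ?s (replicate n 0) ! i"
        using zero[OF x(2)] by simp
      then show ?thesis
        using that len by (simp add: multiperm_apply_def)
    qed
    have "labels (T x y) = map2 (XOR) (labels x) (map2 linear_part ?s (labels y))"
      using x y labels_block_perm[OF perm[OF x(2)] y]
      by (simp add: T_def \<pi>_def labels_vadd)
    \<comment> \<open>In each coordinate, \<open>s 0 XOR (s b XOR s 0) = s b\<close>.\<close>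
    also have "\<dots> = multiperm_apply ?s (labels y)"
      using len by (intro nth_equalityI)
        (simp_all add: multiperm_apply_def s0 linear_part_def ac_simps)
    finally show ?thesis .
  qed
  have T_in: "T x y \<in> concat_code H M"
    if "x \<in> concat_code H M" "y \<in> concat_code H M" for x y
  proof -
    have x: "length x = 4 * n" "parities x \<in> H" "labels x \<in> M"
      and y: "length y = 4 * n" "parities y \<in> H" "labels y \<in> M"
      using that by (auto simp: C)
    \<comment> \<open>Moving bits within blocks keeps the parities, so the closure of
      \<open>H\<close> under addition applies.\<close>
    have "parities (T x y) = vadd (parities x) (parities y)"
      using x y parities_block_perm[OF perm[OF x(3)] y(1)]
      by (simp add: T_def \<pi>_def parities_vadd)
    moreover have "labels (T x y) \<in> M"
      using labels_T[OF that] img x y by auto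
    ultimately show ?thesis
      using Hadd x y by (simp add: C T_def)
  qed
  \<comment> \<open>The code is finite, so each \<open>T x\<close>, mapping the code into itself, is
    onto as soon as it is injective.\<close>
  have "(UNIV :: bit set) = {0, 1}"
    by auto
  then have fin_bit: "finite (UNIV :: bit set)"
    by (metis finite.simps)
  have fin: "finite (concat_code H M)"
    using finite_lists_length_eq[OF fin_bit, of "4 * n"]
    by (rule finite_subset[rotated]) (auto simp: C)
  have inj: "inj_on (T x) (concat_code H M)" if x: "x \<in> concat_code H M" for x
  proof (rule inj_onI, rule nth_equalityI)
    fix y z assume y: "y \<in> concat_code H M" and z: "z \<in> concat_code H M" and eq: "T x y = T x z"
    have len: "length x = 4 * n" "length y = 4 * n" "length z = 4 * n"
      using x y z by (auto simp: C)
    show "length y = length z"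
      using len by simp
    fix k assume k: "k < length y"
    then have pk: "\<pi> x k < 4 * n"
      using permutes_in_image[OF \<pi>[OF x], of k] len by simp
    \<comment> \<open>At place \<open>\<pi> x k\<close> stands entry \<open>k\<close> of the second
      argument plus a bit of \<open>x\<close>, which cancels.\<close>
    have "T x y ! \<pi> x k = x ! \<pi> x k + y ! k" "T x z ! \<pi> x k = x ! \<pi> x k + z ! k"
      using pk k len perm_act_nth[of "\<pi> x" y k] perm_act_nth[of "\<pi> x" z k] \<pi>[OF x]
      by (simp_all add: T_def vadd_def)
    with eq show "y ! k = z ! k" by simp
  qed
  have "T x ` concat_code H M = concat_code H M" if "x \<in> concat_code H M" for x
    using endo_inj_surj[OF fin _ inj[OF that]] T_in[OF that] by blast
  moreover have "\<pi> (T x y) = \<pi> x \<circ> \<pi> y"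
    if "x \<in> concat_code H M" "y \<in> concat_code H M" for x y
  proof -
    have xy: "labels x \<in> M" "labels y \<in> M"
      using that by (auto simp: C)
    show ?thesis
      using labels_T[OF that] comp xy block_perm_comp[OF perm[OF xy(1)] perm[OF xy(2)]]
      by (simp add: \<pi>_def)
  qed
  ultimately show ?thesis
    unfolding propelinear_def T_def using \<pi>
    by (intro conjI exI[of _ \<pi>]) (auto simp: C words_def)
qed

theorem theorem13:
  fixes n :: nat and M :: "nat list set" and H :: "bit list set"
  assumes "quaternary_mds n M"
    and "isotopic_propelinear n M"
    and "extended_hamming_code n H"
  shows "propelinear (4 * n) (concat_code H M) \<and> extended_perfect_code (4 * n) (concat_code H M)"
  using assms concat_code_propelinear concat_code_extended_perfect
  unfolding extended_hamming_code_def by blast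

end
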